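(* In the graph exploration problem with predictions (defined in the context), every algorithm (deterministic or randomized) always incurs cost at least $d(r,g)$. Moreover there is an absolute constant $c>0$ such that for all integers $\Delta\ge 2$ and $D\ge 1$ there is a tree $T$ of maximum degree $\Delta$ with root $r$ and a prediction function $f$ such that, for every (possibly randomized) algorithm, there is a choice of goal $g$ for which $|\mathcal{E}|=D$ and the algorithm's expected cost is at least $c\cdot\Delta\cdot|\mathcal{E}|$. In short, any algorithm must incur cost at least $\max(d(r,g),\Omega(\Delta\cdot|\mathcal{E}|))$.
   Context: Exploration problem: an agent moves in an unknown unweighted graph (here a tree) $T$, starting at a known root $v_0=r$, searching for an unknown goal vertex $g$, which it recognizes only upon visiting it. Each vertex $v$ carries a prediction $f(v)\in\mathbb{Z}$ of its distance to the goal. At each time $t\ge1$ the agent knows the visited vertices $V_{t-1}$, their unvisited neighbors $\partial V_{t-1}$, and the predictions of all these vertices; it moves to a new vertex $v_t\in\partial V_{t-1}$ paying $d(v_{t-1},v_t)$, then observes the neighbors of $v_t$ and their predictions. The cost is the total distance traveled until $g$ is visited. $\mathcal{E}=\{v\mid f(v)\neq d(v,g)\}$ is the set of erroneous vertices. *)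

theory Defs
  imports "HOL-Probability.Probability" "Graph_Theory.Graph_Theory"
begin

text \<open>
  Finite simple undirected graphs are the symmetric loop-free pair digraphs of
  \<open>Graph_Theory\<close> (locale \<^locale>\<open>pair_graph\<close>): an edge is a pair of opposite arcs.
  The predicate \<open>Digraph_Component.tree\<close> cannot be used for them, since for its notion of
  cycle every edge of a symmetric digraph already yields a cycle of length 2;
  in an undirected graph, a cycle has length at least 3.
\<close>

definition is_tree :: "'v pair_pre_digraph \<Rightarrow> bool" where
  "is_tree T \<longleftrightarrow> pair_graph T \<and> Digraph_Component.connected (with_proj T) \<and>
     \<not> (\<exists>p. pre_digraph.cycle (with_proj T) p \<and> length p \<ge> 3)"

definition max_degree :: "'v pair_pre_digraph \<Rightarrow> nat" where
  "max_degree T = Max (out_degree (with_proj T) ` pverts T)"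

definition gdist :: "'v pair_pre_digraph \<Rightarrow> 'v \<Rightarrow> 'v \<Rightarrow> nat" where
  "gdist T u v = (LEAST n. \<exists>p. pre_digraph.awalk (with_proj T) u p v \<and> length p = n)"

definition erroneous :: "'v pair_pre_digraph \<Rightarrow> ('v \<Rightarrow> int) \<Rightarrow> 'v \<Rightarrow> 'v set" where
  "erroneous T f g = {v \<in> pverts T. f v \<noteq> int (gdist T v g)}"

text \<open>
  Visiting a vertex reveals the vertex, its prediction, and its neighbours together with their
  predictions. Everything the agent knows is the list of these observations, oldest first;
  a deterministic algorithm chooses the next vertex from it. The goal itself is not part of an
  observation: the search stops at the goal, so a decision is only ever used while
  the goal has not been visited.
\<close>

type_synonym 'v observation = "'v \<times> int \<times> ('v \<times> int) set"
type_synonym 'v algorithm = "'v observation list \<Rightarrow> 'v"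

definition observe :: "'v pair_pre_digraph \<Rightarrow> ('v \<Rightarrow> int) \<Rightarrow> 'v \<Rightarrow> 'v observation" where
  "observe T f v = (v, f v, {(w, f w) | w. (v, w) \<in> parcs T})"

definition frontier :: "'v observation list \<Rightarrow> 'v set" where
  "frontier h = (\<Union>(v, a, N) \<in> set h. fst ` N) - fst ` set h"

definition exploration_algorithm :: "'v algorithm \<Rightarrow> bool" where
  "exploration_algorithm A \<longleftrightarrow> (\<forall>h. frontier h \<noteq> {} \<longrightarrow> A h \<in> frontier h)"

primrec visits ::
  "'v pair_pre_digraph \<Rightarrow> ('v \<Rightarrow> int) \<Rightarrow> 'v \<Rightarrow> 'v algorithm \<Rightarrow> nat \<Rightarrow> 'v list" where
  "visits T f r A 0 = [r]"
| "visits T f r A (Suc t) =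
     visits T f r A t @ [A (map (observe T f) (visits T f r A t))]"

definition position ::
  "'v pair_pre_digraph \<Rightarrow> ('v \<Rightarrow> int) \<Rightarrow> 'v \<Rightarrow> 'v algorithm \<Rightarrow> nat \<Rightarrow> 'v" where
  "position T f r A t = last (visits T f r A t)"

text \<open>
  The value \<open>\<infinity>\<close> only makes the definition total: see \<open>goal_is_visited\<close> below.
\<close>

definition search_cost ::
  "'v pair_pre_digraph \<Rightarrow> ('v \<Rightarrow> int) \<Rightarrow> 'v \<Rightarrow> 'v \<Rightarrow> 'v algorithm \<Rightarrow> ennreal" where
  "search_cost T f r g A =
     (if \<exists>t. position T f r A t = g
      then of_nat (\<Sum>t < (LEAST t. position T f r A t = g).
             gdist T (position T f r A t) (position T f r A (Suc t)))
      else \<infinity>)"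

text \<open>
  A randomized algorithm is a probability distribution over deterministic algorithms, such that
  every single decision is a random variable. The sigma-algebra is otherwise arbitrary, so
  every source of random bits is covered by its image distribution.
\<close>

definition randomized_algorithm :: "'v algorithm measure \<Rightarrow> bool" where
  "randomized_algorithm M \<longleftrightarrow> prob_space M \<and> (\<forall>A \<in> space M. exploration_algorithm A) \<and>
     (\<forall>h. (\<lambda>A. A h) \<in> measurable M (count_space UNIV))"

definition expected_cost ::
  "'v pair_pre_digraph \<Rightarrow> ('v \<Rightarrow> int) \<Rightarrow> 'v \<Rightarrow> 'v \<Rightarrow> 'v algorithm measure \<Rightarrow> ennreal" where
  "expected_cost T f r g M = (\<integral>\<^sup>+A. search_cost T f r g A \<partial>M)"

lemma randomized_algorithm_return:
  assumes "exploration_algorithm A"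
  shows "randomized_algorithm (return (count_space {A}) A)"
    and "expected_cost T f r g (return (count_space {A}) A) = search_cost T f r g A"
  using assms
  by (auto simp: randomized_algorithm_def expected_cost_def nn_integral_return
      intro!: prob_space_return)

lemma frontier_observe:
  "frontier (map (observe T f) vs) = {w. \<exists>v \<in> set vs. (v, w) \<in> parcs T} - set vs"
  by (force simp: frontier_def observe_def)

lemma length_visits [simp]: "length (visits T f r A t) = Suc t"
  by (induction t) auto

lemma set_visits: "set (visits T f r A t) = position T f r A ` {..t}"
proof (induction t)
  case (Suc t)
  have "{..Suc t} = insert (Suc t) {..t}" by auto
  with Suc show ?case by (simp add: position_def)
qed (simp add: position_def)

lemma goal_is_visited:
  assumes "is_tree T" "r \<in> pverts T" "g \<in> pverts T" "exploration_algorithm A"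
  shows "\<exists>t. position T f r A t = g"
proof (rule ccontr)
  assume no: "\<not> (\<exists>t. position T f r A t = g)"
  interpret pair_graph T using assms(1) by (simp add: is_tree_def)
  have conn: "reachable (with_proj T) r g"
    using assms symmetric_connected_imp_strongly_connected[OF pair_sym_arcs]
    by (auto simp: is_tree_def elim!: strongly_connectedE)
  have ne: "frontier (map (observe T f) vs) \<noteq> {}"
    if "r \<in> set vs" "g \<notin> set vs" for vs
  proof
    assume emp: "frontier (map (observe T f) vs) = {}"
    have "u \<in> set vs \<Longrightarrow> v \<in> set vs" if "reachable (with_proj T) u v" for u v
      using that
    proof (induction rule: reachable_induct)
      case (step x y) then show ?case using emp by (auto simp: frontier_observe)
    qed
    with conn that show False by blast
  qed
  have "distinct (visits T f r A t) \<and> set (visits T f r A t) \<subseteq> pverts T" for t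
  proof (induction t)
    case 0 then show ?case using assms by simp
  next
    case (Suc t)
    let ?vs = "visits T f r A t"
    have "g \<notin> set ?vs" using no by (auto simp: set_visits)
    moreover have "r \<in> set ?vs" by (induction t) auto
    ultimately have "A (map (observe T f) ?vs) \<in> frontier (map (observe T f) ?vs)"
      using ne assms(4) by (auto simp: exploration_algorithm_def)
    with Suc show ?case by (auto simp: frontier_observe dest: in_arcsD2)
  qed
  then have "Suc t \<le> card (pverts T)" for t
    by (metis card_mono distinct_card length_visits pair_finite_verts)
  then show False using not_less_eq_eq by blast
qed

end

theory Submission
  imports Defs
begin

text \<open>
  The lower bound uses a spider with \<open>\<Delta>\<close> legs of length \<open>D\<close>, rooted at its centre, where every
  vertex predicts its distance to the end of a leg other than its own. If the goal is the end of a
  leg, then exactly the \<open>D\<close> vertices of that leg are erroneous. Neither the tree nor the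
  predictions depend on the leg, so the order in which an algorithm reaches the \<open>\<Delta>\<close> leg ends
  does not depend on the goal either, and by the time it reaches the \<open>k\<close>-th one it has visited
  \<open>k\<close> complete legs, which takes at least \<open>k * D\<close> moves. The average over all leg ends is
  at least \<open>\<Delta> * D / 2\<close>; averaging over the randomness as well, some leg end has at least
  this expected cost.
\<close>

section \<open>Walks and distances in trees\<close>

lemma tree_pair_graph: "is_tree T \<Longrightarrow> pair_graph T"
  by (simp add: is_tree_def)

lemma tree_awalk_exists:
  assumes "is_tree T" "u \<in> pverts T" "v \<in> pverts T"
  shows "\<exists>p. pre_digraph.awalk (with_proj T) u p v"
proof -
  interpret pair_graph T using assms(1) by (rule tree_pair_graph)
  have "reachable (with_proj T) u v"
    using assms symmetric_connected_imp_strongly_connected[OF pair_sym_arcs]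
    by (auto simp: is_tree_def elim!: strongly_connectedE)
  then show ?thesis by (simp add: reachable_awalk)
qed

lemma gdist_le:
  assumes "pre_digraph.awalk (with_proj T) u p v"
  shows "gdist T u v \<le> length p"
  unfolding gdist_def using assms by (intro Least_le) blast

lemma gdist_awalk:
  assumes "is_tree T" "u \<in> pverts T" "v \<in> pverts T"
  obtains p where "pre_digraph.awalk (with_proj T) u p v" "length p = gdist T u v"
proof -
  from tree_awalk_exists[OF assms]
  have "\<exists>n p. pre_digraph.awalk (with_proj T) u p v \<and> length p = n" by blast
  then have "\<exists>p. pre_digraph.awalk (with_proj T) u p v \<and> length p = gdist T u v"
    unfolding gdist_def by (rule LeastI_ex)
  then show ?thesis using that by blast
qed

lemma gdist_triangle:
  assumes "is_tree T" "u \<in> pverts T" "v \<in> pverts T" "w \<in> pverts T"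
  shows "gdist T u w \<le> gdist T u v + gdist T v w"
proof -
  interpret pair_graph T using assms(1) by (rule tree_pair_graph)
  obtain p where p: "awalk u p v" "length p = gdist T u v" using assms(1-3) by (rule gdist_awalk)
  obtain q where q: "awalk v q w" "length q = gdist T v w" using assms(1,3,4) by (rule gdist_awalk)
  show ?thesis using gdist_le[OF awalk_appendI[OF p(1) q(1)]] p(2) q(2) by simp
qed

lemma gdist_self: "is_tree T \<Longrightarrow> u \<in> pverts T \<Longrightarrow> gdist T u u = 0"
proof -
  assume T: "is_tree T" and u: "u \<in> pverts T"
  interpret pair_graph T using T by (rule tree_pair_graph)
  show ?thesis using gdist_le[of T u "[]" u] u by (simp add: awalk_Nil_iff)
qed

lemma gdist_pos:
  assumes "is_tree T" "u \<in> pverts T" "v \<in> pverts T" "u \<noteq> v"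
  shows "0 < gdist T u v"
proof -
  interpret pair_graph T using assms(1) by (rule tree_pair_graph)
  obtain p where p: "awalk u p v" "length p = gdist T u v" using assms(1-3) by (rule gdist_awalk)
  have "p \<noteq> []"
  proof
    assume "p = []"
    with p(1) assms(4) show False by (simp add: awalk_Nil_iff)
  qed
  then show ?thesis using p(2) by (metis length_greater_0_conv)
qed

text \<open>A potential certifies a distance: following strictly decreasing arcs from
  \<open>v\<close> gives a walk to \<open>g\<close> of length at most \<open>\<phi> v\<close>, and
  since \<open>\<phi>\<close> drops by at most one per arc, no walk to \<open>g\<close> is
  shorter.\<close>

lemma gdist_eqI:
  assumes T: "is_tree T" and g: "g \<in> pverts T"
    and lip: "\<And>u w. (u, w) \<in> parcs T \<Longrightarrow> \<phi> u \<le> Suc (\<phi> w)"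
    and desc: "\<And>u. u \<in> pverts T \<Longrightarrow> u \<noteq> g \<Longrightarrow> \<exists>w. (u, w) \<in> parcs T \<and> \<phi> w < \<phi> u"
    and "\<phi> g = 0" and v: "v \<in> pverts T"
  shows "gdist T v g = \<phi> v"
proof (rule antisym)
  interpret pair_graph T using T by (rule tree_pair_graph)
  have "\<exists>p. awalk v p g \<and> length p \<le> \<phi> v"
    using v
  proof (induction "\<phi> v" arbitrary: v rule: less_induct)
    case less
    show ?case
    proof (cases "v = g")
      case True
      then show ?thesis using less.prems by (intro exI[of _ "[]"]) (simp add: awalk_Nil_iff)
    next
      case False
      with desc less.prems obtain w where w: "(v, w) \<in> parcs T" "\<phi> w < \<phi> v" by blast
      with less.hyps[of w] obtain p where "awalk w p g" "length p \<le> \<phi> w"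
        using in_arcsD2 by blast
      with w show ?thesis by (intro exI[of _ "(v, w) # p"]) (simp add: awalk_Cons_iff)
    qed
  qed
  then obtain p where "awalk v p g" "length p \<le> \<phi> v" by blast
  then show "gdist T v g \<le> \<phi> v" using gdist_le[of T v p g] by simp
  have "\<phi> u \<le> length p" if "awalk u p g" for u p
    using that
  proof (induction p arbitrary: u)
    case Nil then show ?case using \<open>\<phi> g = 0\<close> by (simp add: awalk_Nil_iff)
  next
    case (Cons e p)
    then have "\<phi> (fst e) \<le> Suc (\<phi> (snd e))" "\<phi> (snd e) \<le> length p" "u = fst e"
      using lip[of "fst e" "snd e"] by (auto simp: awalk_Cons_iff)
    then show ?case by simp
  qed
  moreover obtain p where "awalk v p g" "length p = gdist T v g" using T v g by (rule gdist_awalk)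
  ultimately show "\<phi> v \<le> gdist T v g" by (metis (full_types))
qed

section \<open>Runs of an exploration algorithm up to the first visit to the goal\<close>

lemma root_in_visits: "r \<in> set (visits T f r A t)"
  by (induction t) auto

text \<open>\<open>exploration_algorithm\<close> constrains decisions only at nonempty frontiers.
  Before the goal is found the frontier is nonempty, because a walk from the visited root to the
  unvisited goal must leave the visited set.\<close>

lemma position_Suc_in_frontier:
  assumes "is_tree T" "r \<in> pverts T" "g \<in> pverts T" "exploration_algorithm A"
    and "\<forall>s \<le> t. position T f r A s \<noteq> g"
  shows "position T f r A (Suc t) \<in> frontier (map (observe T f) (visits T f r A t))"
proof -
  interpret pair_graph T using assms(1) by (rule tree_pair_graph)
  let ?vs = "visits T f r A t"
  have g: "g \<notin> set ?vs" using assms(5) by (auto simp: set_visits)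
  obtain p where p: "awalk r p g" using tree_awalk_exists[OF assms(1-3)] by blast
  have "frontier (map (observe T f) ?vs) \<noteq> {}"
  proof
    assume emp: "frontier (map (observe T f) ?vs) = {}"
    have "g \<in> set ?vs" if "u \<in> set ?vs" "awalk u q g" for u q
      using that
    proof (induction q arbitrary: u)
      case (Cons e q)
      then have e: "e \<in> parcs T" "u = fst e" "awalk (snd e) q g" by (simp_all add: awalk_Cons_iff)
      have "snd e \<in> set ?vs"
      proof (rule ccontr)
        assume "snd e \<notin> set ?vs"
        moreover have "(u, snd e) \<in> parcs T" using e by simp
        ultimately have "snd e \<in> frontier (map (observe T f) ?vs)"
          unfolding frontier_observe using Cons.prems(1) by blast
        with emp show False by simp
      qed
      then show ?case using e(3) by (rule Cons.IH)
    qed (simp add: awalk_Nil_iff)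
    from this[OF root_in_visits p] g show False by contradiction
  qed
  with assms(4) show ?thesis by (simp add: exploration_algorithm_def position_def)
qed

lemma visits_Suc: "visits T f r A (Suc t) = visits T f r A t @ [position T f r A (Suc t)]"
  by (simp add: position_def)

text \<open>Each move lands in the frontier, hence at a new vertex of \<open>T\<close>. The strict
  bound \<open>s < t\<close> lets \<open>t\<close> be the hitting time itself, with the goal as last
  vertex of the list.\<close>

lemma visits_until_goal:
  assumes "is_tree T" "r \<in> pverts T" "g \<in> pverts T" "exploration_algorithm A"
    and "\<forall>s < t. position T f r A s \<noteq> g"
  shows "distinct (visits T f r A t)" "set (visits T f r A t) \<subseteq> pverts T"
proof -
  interpret pair_graph T using assms(1) by (rule tree_pair_graph)
  have "distinct (visits T f r A t) \<and> set (visits T f r A t) \<subseteq> pverts T"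
    using assms(5)
  proof (induction t)
    case (Suc t)
    with position_Suc_in_frontier[OF assms(1-4), of t f]
    have "position T f r A (Suc t) \<in> frontier (map (observe T f) (visits T f r A t))" by simp
    with Suc show ?case
      unfolding visits_Suc by (auto simp: frontier_observe dest: in_arcsD2)
  qed (use assms in simp)
  then show "distinct (visits T f r A t)" "set (visits T f r A t) \<subseteq> pverts T" by simp_all
qed

definition hitting_time ::
  "'v pair_pre_digraph \<Rightarrow> ('v \<Rightarrow> int) \<Rightarrow> 'v \<Rightarrow> 'v \<Rightarrow> 'v algorithm \<Rightarrow> nat" where
  "hitting_time T f r g A = (LEAST t. position T f r A t = g)"

context
  fixes T :: "'v pair_pre_digraph" and f :: "'v \<Rightarrow> int" and r g :: 'v and A :: "'v algorithm"
  assumes T: "is_tree T" and r: "r \<in> pverts T" and g: "g \<in> pverts T"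
    and A: "exploration_algorithm A"
begin

lemma position_hitting_time: "position T f r A (hitting_time T f r g A) = g"
  unfolding hitting_time_def using goal_is_visited[OF T r g A] by (rule LeastI_ex)

lemma position_before_hitting_time: "s < hitting_time T f r g A \<Longrightarrow> position T f r A s \<noteq> g"
  unfolding hitting_time_def by (rule not_less_Least)

lemma position_until_hitting_time: "s \<le> hitting_time T f r g A \<Longrightarrow> position T f r A s \<in> pverts T"
  using visits_until_goal(2)[OF T r g A, of s f] position_before_hitting_time
  by (force simp: set_visits)

lemma search_cost_eq:
  "search_cost T f r g A = of_nat (\<Sum>t < hitting_time T f r g A.
     gdist T (position T f r A t) (position T f r A (Suc t)))"
  unfolding search_cost_def hitting_time_def using goal_is_visited[OF T r g A, of f] by simp

text \<open>The triangle inequality, accumulated over the prefixes of the run up to the hitting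
  time.\<close>

lemma gdist_le_search_cost: "of_nat (gdist T r g) \<le> search_cost T f r g A"
proof -
  have "gdist T r (position T f r A t) \<le>
      (\<Sum>s < t. gdist T (position T f r A s) (position T f r A (Suc s)))"
    if "t \<le> hitting_time T f r g A" for t
    using that
  proof (induction t)
    case 0 then show ?case using T r by (simp add: gdist_self position_def)
  next
    case (Suc t)
    have "position T f r A t \<in> pverts T" "position T f r A (Suc t) \<in> pverts T"
      using Suc.prems by (auto intro!: position_until_hitting_time)
    then have "gdist T r (position T f r A (Suc t)) \<le> gdist T r (position T f r A t) +
        gdist T (position T f r A t) (position T f r A (Suc t))"
      by (rule gdist_triangle[OF T r])
    then show ?case using Suc by simp
  qed
  from this[OF order.refl] show ?thesis
    by (simp only: position_hitting_time search_cost_eq of_nat_le_iff)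
qed

text \<open>Positions up to the goal are pairwise distinct, so every move pays at least 1. For the
  lower bound it then suffices to count visited vertices.\<close>

lemma hitting_time_le_search_cost: "of_nat (hitting_time T f r g A) \<le> search_cost T f r g A"
proof -
  have "1 \<le> gdist T (position T f r A t) (position T f r A (Suc t))"
    if t: "t < hitting_time T f r g A" for t
  proof -
    have "distinct (visits T f r A (Suc t))"
      by (rule visits_until_goal(1)[OF T r g A]) (use t position_before_hitting_time in auto)
    then have "position T f r A (Suc t) \<notin> position T f r A ` {..t}"
      unfolding visits_Suc by (simp add: set_visits)
    then have "position T f r A t \<noteq> position T f r A (Suc t)"
      by (metis atMost_iff imageI order.refl)
    then have "0 < gdist T (position T f r A t) (position T f r A (Suc t))"
      using t by (intro gdist_pos[OF T] position_until_hitting_time) auto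
    then show ?thesis by simp
  qed
  then have "(\<Sum>t < hitting_time T f r g A. 1) \<le> (\<Sum>t < hitting_time T f r g A.
      gdist T (position T f r A t) (position T f r A (Suc t)))"
    by (intro sum_mono) simp
  then show ?thesis unfolding search_cost_eq of_nat_le_iff by simp
qed

end

section \<open>Expected cost and measurability\<close>

lemma gdist_le_expected_cost:
  assumes "is_tree T" "r \<in> pverts T" "g \<in> pverts T" "randomized_algorithm M"
  shows "of_nat (gdist T r g) \<le> expected_cost T f r g M"
proof -
  interpret prob_space M using assms(4) by (simp add: randomized_algorithm_def)
  have "(\<integral>\<^sup>+A. of_nat (gdist T r g) \<partial>M) \<le> expected_cost T f r g M"
    unfolding expected_cost_def using assms
    by (intro nn_integral_mono gdist_le_search_cost) (auto simp: randomized_algorithm_def)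
  then show ?thesis by (simp add: emeasure_space_1)
qed

text \<open>For a fixed list of visited vertices the next decision is a random variable by
  definition. A countable vertex type leaves only countably many such lists, so these cases can be
  glued together.\<close>

lemma measurable_visits:
  fixes T :: "'v :: countable pair_pre_digraph"
  assumes "randomized_algorithm M"
  shows "(\<lambda>A. visits T f r A t) \<in> measurable M (count_space UNIV)"
proof (induction t)
  case (Suc t)
  have "(\<lambda>A. vs @ [A (map (observe T f) vs)]) \<in> measurable M (count_space UNIV)" for vs
    using assms unfolding randomized_algorithm_def
    by (intro measurable_compose[of "\<lambda>A. A (map (observe T f) vs)" M "count_space UNIV"
          "\<lambda>w. vs @ [w]"]) auto
  from measurable_compose_countable[OF this Suc] show ?case by simp
qed simp

lemma measurable_hitting_time:
  fixes T :: "'v :: countable pair_pre_digraph"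
  assumes "randomized_algorithm M"
  shows "(\<lambda>A. hitting_time T f r g A) \<in> measurable M (count_space UNIV)"
  unfolding hitting_time_def position_def
  by (intro measurable_Least measurable_compose[OF measurable_visits[OF assms]]) simp

section \<open>Trees on \<open>{..n}\<close> rooted at \<open>0\<close>, given by a parent function
  that decreases labels\<close>

definition parent_graph :: "nat \<Rightarrow> (nat \<Rightarrow> nat) \<Rightarrow> nat pair_pre_digraph" where
  "parent_graph n par = \<lparr> pverts = {..n},
     parcs = {(u, v). 0 < u \<and> u \<le> n \<and> v = par u \<or> 0 < v \<and> v \<le> n \<and> u = par v} \<rparr>"

text \<open>The walk condition in terms of indices, so that the arcs just before and after a given
  arc of a cycle can be addressed.\<close>

lemma pcas_arcs:
  assumes "pcas u p v"
  shows "p \<noteq> [] \<Longrightarrow> fst (p ! 0) = u" "p \<noteq> [] \<Longrightarrow> snd (p ! (length p - 1)) = v"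
    "Suc i < length p \<Longrightarrow> fst (p ! Suc i) = snd (p ! i)"
proof -
  show "p \<noteq> [] \<Longrightarrow> fst (p ! 0) = u" using assms by (cases p) auto
  show "p \<noteq> [] \<Longrightarrow> snd (p ! (length p - 1)) = v"
    using assms by (induction u p v rule: pcas.induct) (auto simp: nth_Cons')
  show "Suc i < length p \<Longrightarrow> fst (p ! Suc i) = snd (p ! i)"
    using assms
  proof (induction p arbitrary: u i)
    case (Cons e p)
    show ?case
    proof (cases i)
      case 0 with Cons.prems show ?thesis by (cases p) auto
    next
      case (Suc k) with Cons show ?thesis by auto
    qed
  qed simp
qed

text \<open>On a cycle, both neighbours of its largest vertex would be the parent of that vertex.\<close>

lemma is_tree_parent_graph:
  assumes par: "\<And>v. 0 < v \<Longrightarrow> par v < v"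
  shows "is_tree (parent_graph n par)" (is "is_tree ?T")
proof -
  have par_le: "par v \<le> n" if "0 < v" "v \<le> n" for v
    using par[of v] that by simp
  have "parcs ?T \<subseteq> {..n} \<times> {..n}"
    by (auto simp: parent_graph_def intro: par_le)
  then have fin: "finite (parcs ?T)" by (rule finite_subset) simp
  interpret pair_graph ?T
  proof
    show "symmetric (with_proj ?T)"
      by (auto simp: symmetric_def sym_def parent_graph_def)
    show "fst e \<noteq> snd e" if "e \<in> parcs ?T" for e
      using that par[of "fst e"] par[of "snd e"] by (auto simp: parent_graph_def)
  qed (use fin in \<open>auto simp: parent_graph_def par_le\<close>)
  have to0: "reachable (with_proj ?T) v 0" if "v \<le> n" for v
    using that
  proof (induction v rule: less_induct)
    case (less v)
    show ?case
    proof (cases "v = 0")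
      case True
      have "0 \<in> pverts ?T" by (simp add: parent_graph_def)
      with True show ?thesis using reachable_refl by simp
    next
      case False
      then have "reachable (with_proj ?T) (par v) 0"
        using less.IH[of "par v"] less.prems par par_le by simp
      moreover have "(v, par v) \<in> parcs ?T" using False less.prems by (simp add: parent_graph_def)
      ultimately show ?thesis by (rule adj_reachable_trans[rotated])
    qed
  qed
  have reach: "reachable (with_proj ?T) u v" if "u \<le> n" "v \<le> n" for u v
    using to0[OF that(1)] to0[OF that(2)] pair_sym_arcs
    by (meson reachable_trans symmetric_reachable)
  have conn: "Digraph_Component.connected (with_proj ?T)"
    unfolding connected_def
  proof (rule strongly_connectedI)
    show "verts (mk_symmetric ?T) \<noteq> {}" by (auto simp: parent_graph_def)
    fix u v assume "u \<in> verts (mk_symmetric ?T)" "v \<in> verts (mk_symmetric ?T)"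
    then have "reachable (with_proj ?T) u v" by (intro reach) (auto simp: parent_graph_def)
    then show "reachable (with_proj (mk_symmetric ?T)) u v"
      using reachable_mk_symmetric_eq[OF pair_sym_arcs] by simp
  qed
  have False if "cycle p" "3 \<le> length p" for p
  proof -
    from that(1) obtain u where u: "awalk u p u" "distinct (tl (pawalk_verts u p))" and ne: "p \<noteq> []"
      by (auto simp: cycle_def)
    have cas: "pcas u p u" and arcs: "set p \<subseteq> parcs ?T" using u by (auto simp: awalk_def)
    \<comment> \<open>The vertices of a walk after its first one are the heads of its arcs.\<close>
    have dist: "distinct (map snd p)" using u(2) awalk_verts_conv'[OF cas] ne by simp
    have "Max (snd ` set p) \<in> snd ` set p" using ne by (intro Max_in) auto
    then obtain i where i: "i < length p" and imax: "snd (p ! i) = Max (snd ` set p)"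
      by (auto simp: in_set_conv_nth)
    have le: "snd (p ! k) \<le> snd (p ! i)" if "k < length p" for k
      unfolding imax using that by (intro Max_ge) auto
    \<comment> \<open>\<open>p ! k\<close> and \<open>p ! l\<close> are the arcs before and after
      \<open>p ! i\<close> in cyclic order. Their heads are the two neighbours on the cycle of the
      largest vertex \<open>snd (p ! i)\<close>. Length at least 3 gives
      \<open>k \<noteq> l\<close>.\<close>
    define k where "k = (if i = 0 then length p - 1 else i - 1)"
    define l where "l = (if Suc i = length p then 0 else Suc i)"
    have kl: "k < length p" "l < length p" "k \<noteq> l"
      using i that(2) by (auto simp: k_def l_def)
    have fk: "fst (p ! i) = snd (p ! k)"
      using pcas_arcs[OF cas] ne i by (cases i) (auto simp: k_def)
    have fl: "fst (p ! l) = snd (p ! i)"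
    proof (cases "Suc i = length p")
      case True
      then have "i = length p - 1" by simp
      then show ?thesis using pcas_arcs(1,2)[OF cas ne] True by (simp add: l_def)
    next
      case False
      then show ?thesis using pcas_arcs(3)[OF cas, of i] i by (simp add: l_def)
    qed
    have "p ! i \<in> parcs ?T" "p ! l \<in> parcs ?T" using arcs i kl by auto
    \<comment> \<open>If the largest vertex were instead the parent of one of these neighbours, that
      neighbour would be larger.\<close>
    then have "snd (p ! k) = par (snd (p ! i))" "snd (p ! l) = par (snd (p ! i))"
      using le[OF kl(1)] le[OF kl(2)] fk fl par[of "snd (p ! k)"] par[of "snd (p ! l)"]
      by (auto simp: parent_graph_def)
    then have "map snd p ! k = map snd p ! l" using kl by simp
    then show False using nth_eq_iff_index_eq[OF dist] kl by (metis length_map)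
  qed
  then show ?thesis using conn pair_graph_axioms unfolding is_tree_def by blast
qed

text \<open>A new vertex is a child or the parent of a visited \<open>x\<close>; in the second case
  the induction hypothesis for \<open>x\<close> and then for \<open>par x\<close> applies. For the
  spider this means that a leg end is reached only after its whole leg.\<close>

lemma parent_in_visits:
  assumes T: "is_tree (parent_graph n par)" and "par 0 = 0" and g: "g \<le> n"
    and A: "exploration_algorithm A"
    and "\<forall>s < t. position (parent_graph n par) f 0 A s \<noteq> g"
    and "v \<in> set (visits (parent_graph n par) f 0 A t)"
  shows "par v \<in> set (visits (parent_graph n par) f 0 A t)"
  using assms(5,6)
proof (induction t arbitrary: v)
  case 0 then show ?case using assms(2) by simp
next
  case (Suc t)
  let ?vs = "visits (parent_graph n par) f 0 A t"
  let ?w = "position (parent_graph n par) f 0 A (Suc t)"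
  have IH: "par x \<in> set ?vs" if "x \<in> set ?vs" for x
    using Suc that by simp
  have "?w \<in> Defs.frontier (map (observe (parent_graph n par) f) ?vs)"
    using Suc.prems by (intro position_Suc_in_frontier[OF T _ _ A, where g = g])
      (use g in \<open>auto simp: parent_graph_def\<close>)
  then obtain x where "x \<in> set ?vs" "x = par ?w \<or> ?w = par x"
    by (auto simp: frontier_observe parent_graph_def)
  then have "par ?w \<in> set ?vs" using IH by auto
  with IH Suc.prems(2) show ?case unfolding visits_Suc by auto
qed

section \<open>The spider: coordinates, degrees and distances\<close>

text \<open>
  The root is \<open>0\<close>, and the vertices at depth \<open>j + 1\<close> are
  \<open>\<Delta> * j + 1, \<dots>, \<Delta> * j + \<Delta>\<close>, one for each leg. By truncated subtraction, the parent of
  every vertex \<open>v > 0\<close>, including the children of the root, is \<open>v - \<Delta>\<close>.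
\<close>

definition spider :: "nat \<Rightarrow> nat \<Rightarrow> nat pair_pre_digraph" where
  "spider \<Delta> L = parent_graph (\<Delta> * L) (\<lambda>v. v - \<Delta>)"

text \<open>Both indices start at 0: with legs of length \<open>L\<close>, leg \<open>i\<close> ends
  at \<open>j = L - 1\<close>, which has depth \<open>L\<close>.\<close>

definition leg_vertex :: "nat \<Rightarrow> nat \<Rightarrow> nat \<Rightarrow> nat" where
  "leg_vertex \<Delta> i j = Suc (\<Delta> * j + i)"

text \<open>This is \<open>v / \<Delta>\<close> rounded up.\<close>

definition depth :: "nat \<Rightarrow> nat \<Rightarrow> nat" where
  "depth \<Delta> v = (v + \<Delta> - 1) div \<Delta>"

lemma leg_vertex_0_diff: "i < \<Delta> \<Longrightarrow> leg_vertex \<Delta> i 0 - \<Delta> = 0"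
  and leg_vertex_Suc_diff: "leg_vertex \<Delta> i (Suc j) - \<Delta> = leg_vertex \<Delta> i j"
  by (simp_all add: leg_vertex_def)

lemma leg_vertex_pos [simp]: "0 < leg_vertex \<Delta> i j"
  by (simp add: leg_vertex_def)

text \<open>Division with remainder by \<open>\<Delta>\<close> recovers both coordinates.\<close>

lemma leg_vertex_eq_iff:
  assumes "i < \<Delta>" "i' < \<Delta>"
  shows "leg_vertex \<Delta> i j = leg_vertex \<Delta> i' j' \<longleftrightarrow> i = i' \<and> j = j'"
proof -
  have "(\<Delta> * j + i) mod \<Delta> = i" "(\<Delta> * j' + i') mod \<Delta> = i'"
    "(\<Delta> * j + i) div \<Delta> = j" "(\<Delta> * j' + i') div \<Delta> = j'"
    using assms by auto
  then show ?thesis unfolding leg_vertex_def by (metis nat.inject)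
qed

lemma leg_vertex_le_iff:
  assumes "i < \<Delta>"
  shows "leg_vertex \<Delta> i j \<le> \<Delta> * L \<longleftrightarrow> j < L"
proof -
  have "\<Delta> * j + i < \<Delta> * L \<longleftrightarrow> (\<Delta> * j + i) div \<Delta> < L"
    using div_less_iff_less_mult[of \<Delta> "\<Delta> * j + i" L] assms by (metis mult.commute not_less_zero gr0I)
  then show ?thesis using assms by (simp add: leg_vertex_def Suc_le_eq)
qed

lemma spider_vertex_cases:
  assumes "v \<le> \<Delta> * L"
  obtains "v = 0" | i j where "i < \<Delta>" "j < L" "v = leg_vertex \<Delta> i j"
proof (cases "v = 0")
  case False
  then have \<Delta>: "0 < \<Delta>" using assms by (cases \<Delta>) auto
  have "v = leg_vertex \<Delta> ((v - 1) mod \<Delta>) ((v - 1) div \<Delta>)"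
    using False by (simp add: leg_vertex_def)
  then show ?thesis using that(2) \<Delta> assms leg_vertex_le_iff by (metis mod_less_divisor)
qed

lemma depth_0 [simp]: "0 < \<Delta> \<Longrightarrow> depth \<Delta> 0 = 0"
  by (simp add: depth_def)

lemma depth_leg_vertex [simp]: "i < \<Delta> \<Longrightarrow> depth \<Delta> (leg_vertex \<Delta> i j) = Suc j"
proof -
  assume i: "i < \<Delta>"
  have "leg_vertex \<Delta> i j + \<Delta> - 1 = i + \<Delta> * Suc j" by (simp add: leg_vertex_def)
  then show ?thesis using i unfolding depth_def by (simp only: div_mult_self2) simp
qed

lemma pverts_spider [simp]: "pverts (spider \<Delta> L) = {..\<Delta> * L}"
  by (simp add: spider_def parent_graph_def)

lemma is_tree_spider: "0 < \<Delta> \<Longrightarrow> is_tree (spider \<Delta> L)"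
  unfolding spider_def by (intro is_tree_parent_graph) simp

lemma parcs_spider:
  "(u, v) \<in> parcs (spider \<Delta> L) \<longleftrightarrow>
     (\<exists>i < \<Delta>. \<exists>j < L. u = leg_vertex \<Delta> i j \<and> v = leg_vertex \<Delta> i j - \<Delta> \<or>
       v = leg_vertex \<Delta> i j \<and> u = leg_vertex \<Delta> i j - \<Delta>)"
  (is "?l \<longleftrightarrow> ?r")
proof
  assume ?l
  then have "(0 < u \<and> u \<le> \<Delta> * L \<and> v = u - \<Delta>) \<or> (0 < v \<and> v \<le> \<Delta> * L \<and> u = v - \<Delta>)"
    by (auto simp: spider_def parent_graph_def)
  then show ?r by (metis less_irrefl spider_vertex_cases)
next
  assume ?r
  then obtain i j where "i < \<Delta>" "j < L"
    and "u = leg_vertex \<Delta> i j \<and> v = leg_vertex \<Delta> i j - \<Delta> \<or>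
      v = leg_vertex \<Delta> i j \<and> u = leg_vertex \<Delta> i j - \<Delta>" by blast
  moreover from this have "leg_vertex \<Delta> i j \<le> \<Delta> * L" by (simp add: leg_vertex_le_iff)
  moreover have "0 < leg_vertex \<Delta> i j" by simp
  ultimately show ?l unfolding spider_def parent_graph_def
    by (simp del: leg_vertex_pos) metis
qed

text \<open>The centre has \<open>\<Delta>\<close> children; any other vertex has its parent and at
  most one child, so its degree is at most 2, which is where \<open>2 \<le> \<Delta>\<close>
  enters.\<close>

lemma max_degree_spider:
  assumes "2 \<le> \<Delta>" "0 < L"
  shows "max_degree (spider \<Delta> L) = \<Delta>"
proof -
  let ?T = "spider \<Delta> L"
  have arcs0: "out_arcs (with_proj ?T) 0 = (\<lambda>i. (0, leg_vertex \<Delta> i 0)) ` {..<\<Delta>}"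
  proof (intro equalityI subsetI)
    fix e assume "e \<in> out_arcs (with_proj ?T) 0"
    then have "(0, snd e) \<in> parcs ?T" "e = (0, snd e)" by (cases e; simp)+
    then obtain i j where ij: "i < \<Delta>" "snd e = leg_vertex \<Delta> i j" "0 = leg_vertex \<Delta> i j - \<Delta>"
      unfolding parcs_spider by (metis leg_vertex_pos less_irrefl)
    \<comment> \<open>Deeper vertices have a nonzero parent.\<close>
    have "j = 0"
    proof (cases j)
      case (Suc k)
      with ij(3) show ?thesis by (metis leg_vertex_Suc_diff leg_vertex_pos less_irrefl)
    qed simp
    with ij \<open>e = (0, snd e)\<close> have "e = (0, leg_vertex \<Delta> i 0)" by simp
    with ij(1) show "e \<in> (\<lambda>i. (0 :: nat, leg_vertex \<Delta> i 0)) ` {..<\<Delta>}" by blast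
  next
    fix e assume "e \<in> (\<lambda>i. (0 :: nat, leg_vertex \<Delta> i 0)) ` {..<\<Delta>}"
    then obtain i where i: "i < \<Delta>" "e = (0, leg_vertex \<Delta> i 0)" by blast
    then have "(0, leg_vertex \<Delta> i 0) \<in> parcs ?T"
      unfolding parcs_spider using assms(2) leg_vertex_0_diff by metis
    then show "e \<in> out_arcs (with_proj ?T) 0" using i by simp
  qed
  have "inj_on (\<lambda>i. (0 :: nat, leg_vertex \<Delta> i 0)) {..<\<Delta>}"
    by (auto simp: inj_on_def leg_vertex_eq_iff)
  then have deg0: "out_degree (with_proj ?T) 0 = \<Delta>"
    unfolding out_degree_def arcs0 by (simp add: card_image)
  have "out_degree (with_proj ?T) v \<le> \<Delta>" if v: "v \<le> \<Delta> * L" for v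
    using v
  proof (cases rule: spider_vertex_cases)
    case 1 then show ?thesis using deg0 by simp
  next
    case (2 i j)
    \<comment> \<open>Only an inclusion: at a leg end \<open>v + \<Delta>\<close> is no longer a
      vertex.\<close>
    have "out_arcs (with_proj ?T) v \<subseteq> {(v, v - \<Delta>), (v, v + \<Delta>)}"
    proof
      fix e assume "e \<in> out_arcs (with_proj ?T) v"
      then have "e = (v, snd e)" "v - \<Delta> = snd e \<or> 0 < snd e \<and> v = snd e - \<Delta>"
        by (cases e; auto simp: spider_def parent_graph_def)+
      moreover have "0 < v" using 2 by simp
      ultimately have "snd e = v - \<Delta> \<or> snd e = v + \<Delta>" by linarith
      with \<open>e = (v, snd e)\<close> show "e \<in> {(v, v - \<Delta>), (v, v + \<Delta>)}" by (metis insertCI)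
    qed
    then have "out_degree (with_proj ?T) v \<le> card {(v, v - \<Delta>), (v, v + \<Delta>)}"
      unfolding out_degree_def by (intro card_mono) auto
    also have "\<dots> \<le> 2" by (simp add: card_insert_if)
    finally show ?thesis using assms by simp
  qed
  then show ?thesis unfolding max_degree_def
    by (intro Max_eqI) (auto intro!: image_eqI[of _ _ 0] simp: deg0)
qed

text \<open>For \<open>v > 0\<close>, \<open>(v - 1) mod \<Delta>\<close> is the leg of
  \<open>v\<close>. From the goal's own leg one walks outward, from elsewhere through the centre.
  The formula is verified as a potential in the sense of \<open>gdist_eqI\<close>.\<close>

lemma gdist_spider:
  assumes i: "i < \<Delta>" and L: "0 < L" and v: "v \<le> \<Delta> * L"
  shows "gdist (spider \<Delta> L) v (leg_vertex \<Delta> i (L - 1)) =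
    (if 0 < v \<and> (v - 1) mod \<Delta> = i then L - depth \<Delta> v else L + depth \<Delta> v)"
    (is "_ = ?\<phi> v")
proof -
  have \<Delta>: "0 < \<Delta>" using i by simp
  have \<phi>0: "?\<phi> 0 = L" using \<Delta> by simp
  have \<phi>leg: "?\<phi> (leg_vertex \<Delta> k j) = (if k = i then L - Suc j else L + Suc j)" if "k < \<Delta>" for k j
  proof -
    have "(leg_vertex \<Delta> k j - 1) mod \<Delta> = k" using that by (simp add: leg_vertex_def)
    then show ?thesis using that by simp
  qed
  \<comment> \<open>The value at the parent. For \<open>j = 0\<close> the parent is the centre, and
    both branches correctly give \<open>L\<close>.\<close>
  have \<phi>diff: "?\<phi> (leg_vertex \<Delta> k j - \<Delta>) = (if k = i then L - j else L + j)" if "k < \<Delta>" for k j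
  proof (cases j)
    case 0
    then show ?thesis using \<phi>0 leg_vertex_0_diff[OF that] by simp
  next
    case (Suc j')
    then show ?thesis using \<phi>leg[OF that] leg_vertex_Suc_diff by metis
  qed
  show ?thesis
  proof (rule gdist_eqI[where \<phi> = ?\<phi>])
    show "is_tree (spider \<Delta> L)" using \<Delta> by (rule is_tree_spider)
    show "leg_vertex \<Delta> i (L - 1) \<in> pverts (spider \<Delta> L)"
      using i L by (simp add: leg_vertex_le_iff)
    show "?\<phi> (leg_vertex \<Delta> i (L - 1)) = 0" unfolding \<phi>leg[OF i] using L by simp
    show "v \<in> pverts (spider \<Delta> L)" using v by simp
    have near: "?\<phi> (leg_vertex \<Delta> k j) \<le> Suc (?\<phi> (leg_vertex \<Delta> k j - \<Delta>)) \<and>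
        ?\<phi> (leg_vertex \<Delta> k j - \<Delta>) \<le> Suc (?\<phi> (leg_vertex \<Delta> k j))" if "k < \<Delta>" "j < L" for k j
      unfolding \<phi>leg[OF that(1)] \<phi>diff[OF that(1)] by auto
    show "?\<phi> u \<le> Suc (?\<phi> w)" if "(u, w) \<in> parcs (spider \<Delta> L)" for u w
      using that near unfolding parcs_spider by metis
    show "\<exists>w. (u, w) \<in> parcs (spider \<Delta> L) \<and> ?\<phi> w < ?\<phi> u"
      if "u \<in> pverts (spider \<Delta> L)" "u \<noteq> leg_vertex \<Delta> i (L - 1)" for u
    proof -
      from that(1) have "u \<le> \<Delta> * L" by simp
      then show ?thesis
      proof (cases rule: spider_vertex_cases)
        case 1
        have "(u, leg_vertex \<Delta> i 0) \<in> parcs (spider \<Delta> L)"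
          unfolding parcs_spider 1 using i L leg_vertex_0_diff by metis
        moreover have "?\<phi> (leg_vertex \<Delta> i 0) < ?\<phi> u"
          using L \<phi>0 unfolding 1 \<phi>leg[OF i] by simp
        ultimately show ?thesis by blast
      next
        case (2 k j)
        show ?thesis
        proof (cases "k = i")
          case True
          \<comment> \<open>As \<open>u\<close> is not the goal, its leg continues outward. The
            potential falls away from the centre on this leg and towards the centre on all
            others.\<close>
          with 2 that(2) have j: "Suc j < L" by (cases "Suc j = L") auto
          have "(u, leg_vertex \<Delta> i (Suc j)) \<in> parcs (spider \<Delta> L)"
            unfolding parcs_spider 2(3) True using i j leg_vertex_Suc_diff by metis
          moreover have "?\<phi> (leg_vertex \<Delta> i (Suc j)) < ?\<phi> u"
            unfolding 2(3) True \<phi>leg[OF i] using j by simp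
          ultimately show ?thesis by blast
        next
          case False
          have "(u, u - \<Delta>) \<in> parcs (spider \<Delta> L)"
            unfolding parcs_spider using 2 by blast
          moreover have "?\<phi> (u - \<Delta>) < ?\<phi> u"
            unfolding 2(3) \<phi>leg[OF 2(1)] \<phi>diff[OF 2(1)] using False by simp
          ultimately show ?thesis by blast
        qed
      qed
    qed
  qed
qed

section \<open>Predictions on the spider and their errors\<close>

definition spider_prediction :: "nat \<Rightarrow> nat \<Rightarrow> nat \<Rightarrow> int" where
  "spider_prediction \<Delta> L v = int (L + depth \<Delta> v)"

text \<open>On the goal's leg the prediction exceeds the distance by twice the depth, which is
  positive there; at the centre and on all other legs it is exact.\<close>

lemma card_erroneous_spider:
  assumes i: "i < \<Delta>" and L: "0 < L"
  shows "card (erroneous (spider \<Delta> L) (spider_prediction \<Delta> L) (leg_vertex \<Delta> i (L - 1))) = L"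
proof -
  have "v \<in> erroneous (spider \<Delta> L) (spider_prediction \<Delta> L) (leg_vertex \<Delta> i (L - 1)) \<longleftrightarrow>
      v \<in> leg_vertex \<Delta> i ` {..<L}" for v
  proof (cases "v \<le> \<Delta> * L")
    case True
    then show ?thesis
    proof (cases rule: spider_vertex_cases)
      case 1
      have "gdist (spider \<Delta> L) 0 (leg_vertex \<Delta> i (L - 1)) = L"
        using gdist_spider[OF i L, of 0] i by simp
      moreover have "0 \<notin> leg_vertex \<Delta> i ` {..<L}" by (metis imageE leg_vertex_pos less_irrefl)
      ultimately show ?thesis using 1 i by (simp add: erroneous_def spider_prediction_def)
    next
      case (2 k j)
      have "(leg_vertex \<Delta> k j - 1) mod \<Delta> = k" using 2 by (simp add: leg_vertex_def)
      then have "v \<in> erroneous (spider \<Delta> L) (spider_prediction \<Delta> L) (leg_vertex \<Delta> i (L - 1)) \<longleftrightarrow> k = i"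
        using gdist_spider[OF i L True] 2 True L
        by (auto simp: erroneous_def spider_prediction_def)
      moreover have "v \<in> leg_vertex \<Delta> i ` {..<L} \<longleftrightarrow> k = i"
        using 2 i by (auto simp: leg_vertex_eq_iff)
      ultimately show ?thesis by simp
    qed
  next
    case False
    then show ?thesis using i by (auto simp: erroneous_def leg_vertex_le_iff)
  qed
  then have "erroneous (spider \<Delta> L) (spider_prediction \<Delta> L) (leg_vertex \<Delta> i (L - 1)) =
      leg_vertex \<Delta> i ` {..<L}" by blast
  moreover have "inj_on (leg_vertex \<Delta> i) {..<L}" using i by (auto simp: inj_on_def leg_vertex_eq_iff)
  ultimately show ?thesis by (simp add: card_image)
qed

section \<open>Counting completed legs, and averaging over the leg ends\<close>

text \<open>All \<open>\<tau> k\<close> refer to one and the same run, since positions do not depend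
  on the goal. The legs whose ends are reached by time \<open>\<tau> i\<close> are then fully
  visited, and they are disjoint.\<close>

lemma completed_legs_le_hitting_time:
  fixes \<Delta> L :: nat and f :: "nat \<Rightarrow> int" and A :: "nat algorithm"
  defines "\<tau> \<equiv> \<lambda>i. hitting_time (spider \<Delta> L) f 0 (leg_vertex \<Delta> i (L - 1)) A"
  assumes i: "i < \<Delta>" and L: "0 < L" and A: "exploration_algorithm A"
  shows "L * card {k \<in> {..<\<Delta>}. \<tau> k \<le> \<tau> i} \<le> \<tau> i"
proof -
  let ?T = "spider \<Delta> L" and ?g = "\<lambda>k. leg_vertex \<Delta> k (L - 1)"
  let ?S = "set (visits ?T f 0 A (\<tau> i))" and ?K = "{k \<in> {..<\<Delta>}. \<tau> k \<le> \<tau> i}"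
  have T: "is_tree ?T" using i by (intro is_tree_spider) simp
  have g: "?g k \<in> pverts ?T" if "k < \<Delta>" for k using that L by (simp add: leg_vertex_le_iff)
  have r: "0 \<in> pverts ?T" by simp
  have before: "\<forall>s < \<tau> i. position ?T f 0 A s \<noteq> ?g i"
    unfolding \<tau>_def using position_before_hitting_time[OF T r g[OF i] A] by blast
  have closed: "v - \<Delta> \<in> ?S" if "v \<in> ?S" for v
    unfolding spider_def
    using parent_in_visits[of "\<Delta> * L" "\<lambda>v. v - \<Delta>" "?g i" A "\<tau> i" f v] T g[OF i] A before that
    by (simp add: spider_def parent_graph_def)
  have leg: "leg_vertex \<Delta> k j \<in> ?S" if "k \<in> ?K" "j < L" for k j
  proof -
    have "?g k = position ?T f 0 A (\<tau> k)"
      unfolding \<tau>_def using that position_hitting_time[OF T r g A] by simp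
    then have end_leg: "?g k \<in> ?S" using that by (auto simp: set_visits)
    \<comment> \<open>Induction from the leg end inwards, one parent at a time.\<close>
    have "j \<le> L - 1" using that by simp
    then show ?thesis
      by (induction rule: inc_induct) (use end_leg closed leg_vertex_Suc_diff in \<open>metis+\<close>)
  qed
  have "(\<lambda>(k, j). leg_vertex \<Delta> k j) ` (?K \<times> {..<L}) \<subseteq> ?S - {0}"
    using leg by (auto simp: leg_vertex_def)
  moreover have "inj_on (\<lambda>(k, j). leg_vertex \<Delta> k j) (?K \<times> {..<L})"
    by (auto simp: inj_on_def leg_vertex_eq_iff)
  ultimately have "card (?K \<times> {..<L}) \<le> card (?S - {0})"
    by (metis (no_types, lifting) card_image card_mono finite_Diff finite_set)
  \<comment> \<open>By time \<open>\<tau> i\<close> there are \<open>\<tau> i + 1\<close> visited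
    vertices; the root, which lies on no leg, accounts for the extra one.\<close>
  also have "\<dots> = card ?S - 1" by (simp add: root_in_visits)
  also have "card ?S = Suc (\<tau> i)"
    using visits_until_goal(1)[OF T r g[OF i] A before] by (simp add: distinct_card)
  finally show ?thesis by (simp add: mult.commute)
qed

text \<open>Each ordered pair \<open>(i, k)\<close> satisfies \<open>t k \<le> t i\<close> or
  \<open>t i \<le> t k\<close>, and by symmetry both conditions hold for equally many pairs. Ties
  only increase the sum.\<close>

lemma sum_card_le_ge:
  fixes t :: "'i \<Rightarrow> 'a :: linorder"
  assumes "finite I"
  shows "card I * card I \<le> 2 * (\<Sum>i\<in>I. card {k \<in> I. t k \<le> t i})"
proof -
  let ?b = "\<lambda>i k. if t k \<le> t i then 1 else 0 :: nat"
  have card: "card {k \<in> I. t k \<le> t i} = (\<Sum>k\<in>I. ?b i k)" for i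
    using assms by (simp add: sum.If_cases Int_def)
  have "card I * card I = (\<Sum>i\<in>I. \<Sum>k\<in>I. 1)" by simp
  also have "\<dots> \<le> (\<Sum>i\<in>I. \<Sum>k\<in>I. ?b i k + ?b k i)" by (intro sum_mono) auto
  also have "\<dots> = (\<Sum>i\<in>I. \<Sum>k\<in>I. ?b i k) + (\<Sum>i\<in>I. \<Sum>k\<in>I. ?b k i)" by (simp only: sum.distrib)
  also have "(\<Sum>i\<in>I. \<Sum>k\<in>I. ?b k i) = (\<Sum>i\<in>I. \<Sum>k\<in>I. ?b i k)" by (rule sum.swap)
  finally show ?thesis unfolding card by (simp only: mult_2)
qed

lemma sum_hitting_time_spider:
  assumes L: "0 < L" and A: "exploration_algorithm A"
  shows "L * (\<Delta> * \<Delta>) \<le> 2 * (\<Sum>i<\<Delta>. hitting_time (spider \<Delta> L) f 0 (leg_vertex \<Delta> i (L - 1)) A)"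
    (is "_ \<le> 2 * (\<Sum>i<\<Delta>. ?\<tau> i)")
proof -
  have "L * (\<Delta> * \<Delta>) \<le> L * (2 * (\<Sum>i<\<Delta>. card {k \<in> {..<\<Delta>}. ?\<tau> k \<le> ?\<tau> i}))"
    using sum_card_le_ge[of "{..<\<Delta>}" ?\<tau>] by simp
  also have "\<dots> = 2 * (\<Sum>i<\<Delta>. L * card {k \<in> {..<\<Delta>}. ?\<tau> k \<le> ?\<tau> i})"
    by (simp add: sum_distrib_left mult.left_commute)
  also have "\<dots> \<le> 2 * (\<Sum>i<\<Delta>. ?\<tau> i)"
    by (intro mult_left_mono sum_mono completed_legs_le_hitting_time) (use L A in auto)
  finally show ?thesis .
qed

text \<open>Averaging over goals: the bound on the sum over all leg ends holds for every
  deterministic algorithm, so it survives integration, and the leg end of largest expected cost is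
  at least average. The leg depends on \<open>M\<close> but not on the random outcome.\<close>

lemma spider_expected_cost:
  assumes \<Delta>: "0 < \<Delta>" and L: "0 < L" and M: "randomized_algorithm M"
  shows "\<exists>i < \<Delta>. ennreal (1/2 * real \<Delta> * real L)
    \<le> expected_cost (spider \<Delta> L) f 0 (leg_vertex \<Delta> i (L - 1)) M"
proof -
  let ?T = "spider \<Delta> L" and ?g = "\<lambda>i. leg_vertex \<Delta> i (L - 1)"
  let ?c = "\<lambda>i. expected_cost ?T f 0 (?g i) M"
  interpret prob_space M using M by (simp add: randomized_algorithm_def)
  have A: "exploration_algorithm A" if "A \<in> space M" for A
    using M that by (simp add: randomized_algorithm_def)
  have T: "is_tree ?T" using \<Delta> by (rule is_tree_spider)
  have g: "?g i \<in> pverts ?T" if "i < \<Delta>" for i using that L by (simp add: leg_vertex_le_iff)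
  \<comment> \<open>Sum and integral are exchanged for the hitting times; the costs come in only
    afterwards, by monotonicity.\<close>
  have meas: "(\<lambda>A. of_nat (hitting_time ?T f 0 (?g i) A) :: ennreal) \<in> borel_measurable M" for i
    by (rule measurable_compose[OF measurable_hitting_time[OF M]]) simp
  have half: "ennreal (1/2 * real L * (real \<Delta> * real \<Delta>)) \<le> (\<Sum>i<\<Delta>. of_nat (hitting_time ?T f 0 (?g i) A))"
    if "A \<in> space M" for A
  proof -
    have "real (L * (\<Delta> * \<Delta>)) \<le> real (2 * (\<Sum>i<\<Delta>. hitting_time ?T f 0 (?g i) A))"
      using sum_hitting_time_spider[OF L A[OF that]] by (rule of_nat_mono)
    then have "ennreal (1/2 * real L * (real \<Delta> * real \<Delta>)) \<le>
        ennreal (real (\<Sum>i<\<Delta>. hitting_time ?T f 0 (?g i) A))"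
      by (intro ennreal_leI) simp
    also have "\<dots> = of_nat (\<Sum>i<\<Delta>. hitting_time ?T f 0 (?g i) A)"
      by (rule ennreal_of_nat_eq_real_of_nat[symmetric])
    finally show ?thesis by simp
  qed
  obtain i where i: "i < \<Delta>" and max: "\<And>k. k < \<Delta> \<Longrightarrow> ?c k \<le> ?c i"
  proof -
    have "Max (?c ` {..<\<Delta>}) \<in> ?c ` {..<\<Delta>}" using \<Delta> by (intro Max_in) auto
    then obtain i where "i < \<Delta>" "?c i = Max (?c ` {..<\<Delta>})" by auto
    then show ?thesis using that[of i] by simp
  qed
  have "ennreal (real \<Delta>) * ennreal (1/2 * real \<Delta> * real L) =
      (\<integral>\<^sup>+A. ennreal (1/2 * real L * (real \<Delta> * real \<Delta>)) \<partial>M)"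
    by (simp add: emeasure_space_1 ennreal_mult[symmetric] mult_ac)
  also have "\<dots> \<le> (\<integral>\<^sup>+A. (\<Sum>i<\<Delta>. of_nat (hitting_time ?T f 0 (?g i) A)) \<partial>M)"
    by (intro nn_integral_mono half)
  also have "\<dots> = (\<Sum>i<\<Delta>. \<integral>\<^sup>+A. of_nat (hitting_time ?T f 0 (?g i) A) \<partial>M)"
    by (intro nn_integral_sum meas)
  also have "\<dots> \<le> (\<Sum>i<\<Delta>. ?c i)"
    unfolding expected_cost_def
    by (intro sum_mono nn_integral_mono hitting_time_le_search_cost[OF T]) (use g A in auto)
  also have "\<dots> \<le> (\<Sum>k<\<Delta>. ?c i)" using max by (intro sum_mono) simp
  also have "\<dots> = ennreal (real \<Delta>) * ?c i" by (simp add: ennreal_of_nat_eq_real_of_nat)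
  \<comment> \<open>The factor \<open>\<Delta>\<close> cancels in \<open>ennreal\<close> because it
    is positive and finite.\<close>
  finally have "ennreal (1/2 * real \<Delta> * real L) \<le> ?c i"
    using \<Delta> by (subst (asm) ennreal_mult_le_mult_iff) auto
  then show ?thesis using i by blast
qed

theorem mainTheorem2:
  shows "(\<forall>(T :: 'v pair_pre_digraph) f r g.
            is_tree T \<and> r \<in> pverts T \<and> g \<in> pverts T \<longrightarrow>
              (\<forall>A. exploration_algorithm A \<longrightarrow> of_nat (gdist T r g) \<le> search_cost T f r g A) \<and>
              (\<forall>M. randomized_algorithm M \<longrightarrow>
                 (\<forall>A \<in> space M. of_nat (gdist T r g) \<le> search_cost T f r g A) \<and>
                 of_nat (gdist T r g) \<le> expected_cost T f r g M)) \<and>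
         (\<exists>c :: real. c > 0 \<and>
            (\<forall>\<Delta> \<ge> 2. \<forall>D \<ge> 1.
               \<exists>(T :: nat pair_pre_digraph) r f.
                 is_tree T \<and> max_degree T = \<Delta> \<and> r \<in> pverts T \<and>
                 (\<forall>M. randomized_algorithm M \<longrightarrow>
                    (\<exists>g \<in> pverts T.
                       card (erroneous T f g) = D \<and>
                       ennreal (c * real \<Delta> * real (card (erroneous T f g)))
                         \<le> expected_cost T f r g M))))"
proof (intro conjI)
  show "\<forall>(T :: 'v pair_pre_digraph) f r g.
            is_tree T \<and> r \<in> pverts T \<and> g \<in> pverts T \<longrightarrow>
              (\<forall>A. exploration_algorithm A \<longrightarrow> of_nat (gdist T r g) \<le> search_cost T f r g A) \<and>
              (\<forall>M. randomized_algorithm M \<longrightarrow>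
                 (\<forall>A \<in> space M. of_nat (gdist T r g) \<le> search_cost T f r g A) \<and>
                 of_nat (gdist T r g) \<le> expected_cost T f r g M)"
  proof (intro allI impI conjI ballI)
    fix T :: "'v pair_pre_digraph" and f r g and M :: "'v algorithm measure"
    assume T: "is_tree T \<and> r \<in> pverts T \<and> g \<in> pverts T"
    show search: "of_nat (gdist T r g) \<le> search_cost T f r g A" if "exploration_algorithm A" for A
      using T that by (intro gdist_le_search_cost) simp_all
    assume M: "randomized_algorithm M"
    show "of_nat (gdist T r g) \<le> expected_cost T f r g M"
      using T M by (intro gdist_le_expected_cost) simp_all
    show "of_nat (gdist T r g) \<le> search_cost T f r g A" if "A \<in> space M" for A
      using M that by (intro search) (simp add: randomized_algorithm_def)
  qed
next
  show "\<exists>c :: real. c > 0 \<and>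
            (\<forall>\<Delta> \<ge> 2. \<forall>D \<ge> 1.
               \<exists>(T :: nat pair_pre_digraph) r f.
                 is_tree T \<and> max_degree T = \<Delta> \<and> r \<in> pverts T \<and>
                 (\<forall>M. randomized_algorithm M \<longrightarrow>
                    (\<exists>g \<in> pverts T.
                       card (erroneous T f g) = D \<and>
                       ennreal (c * real \<Delta> * real (card (erroneous T f g)))
                         \<le> expected_cost T f r g M)))"
  \<comment> \<open>The constant 1/2 comes from the pair count in
    \<open>sum_card_le_ge\<close>.\<close>
  proof (intro exI[of _ "1/2 :: real"] conjI allI impI)
    fix \<Delta> D :: nat
    assume \<Delta>: "2 \<le> \<Delta>" and D: "1 \<le> D"
    \<comment> \<open>Legs of length \<open>D\<close>, because the errors fill exactly one
      leg.\<close>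
    let ?T = "spider \<Delta> D" and ?f = "spider_prediction \<Delta> D"
    have "\<exists>g \<in> pverts ?T. card (erroneous ?T ?f g) = D \<and>
        ennreal (1/2 * real \<Delta> * real (card (erroneous ?T ?f g))) \<le> expected_cost ?T ?f 0 g M"
      if M: "randomized_algorithm M" for M
    proof -
      obtain i where i: "i < \<Delta>" and
        cost: "ennreal (1/2 * real \<Delta> * real D) \<le> expected_cost ?T ?f 0 (leg_vertex \<Delta> i (D - 1)) M"
        using spider_expected_cost[OF _ _ M, of \<Delta> D ?f] \<Delta> D by auto
      have "card (erroneous ?T ?f (leg_vertex \<Delta> i (D - 1))) = D"
        using i D by (intro card_erroneous_spider) simp_all
      moreover have "leg_vertex \<Delta> i (D - 1) \<in> pverts ?T"
        using i D by (simp add: leg_vertex_le_iff)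
      ultimately show ?thesis using cost by (metis (no_types, lifting))
    qed
    then show "\<exists>(T :: nat pair_pre_digraph) r f.
        is_tree T \<and> max_degree T = \<Delta> \<and> r \<in> pverts T \<and>
        (\<forall>M. randomized_algorithm M \<longrightarrow>
          (\<exists>g \<in> pverts T. card (erroneous T f g) = D \<and>
            ennreal (1/2 * real \<Delta> * real (card (erroneous T f g))) \<le> expected_cost T f r g M))"
      using \<Delta> D
      by (intro exI[of _ ?T] exI[of _ 0] exI[of _ ?f] conjI is_tree_spider max_degree_spider allI impI)
        simp_all
  qed simp
qed

end
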